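(* Let $\operatorname{conv}\colon \mathbb{R}^{d_{in}\times h_{in}\times w_{in}}\to\mathbb{R}^{d_{out}\times h_{out}\times w_{out}}$ be a 2D multi-channel convolutional layer with kernel $K\in\mathbb{R}^{d_{out}\times d_{in}\times k_1\times k_2}$, vertical stride $s_1$, horizontal stride $s_2$, and padding sizes $p_1$ (vertical) and $p_2$ (horizontal). Let $c_1$ and $c_2$ be the smallest positive integers such that $c_1s_1\ge p_1$ and $c_2s_2\ge p_2$, and assume that $k_1+c_1s_1-p_1\le h_{in}$ and $k_2+c_2s_2-p_2\le w_{in}$, and that the padding (if any) is zero padding. Let $\mathcal{S}$ be the set of index sets defined in the context. Then $$\|\operatorname{conv}\|_1=\max_{1\le j\le d_{in}}\ \max_{\mathcal{A}\in\mathcal{S}}\ \sum_{(k,t)\in\mathcal{A}}\ \sum_{i=1}^{d_{out}}|K_{i,j,k,t}|,$$ $$\|\operatorname{conv}\|_\infty=\max_{1\le i\le d_{out}}\ \sum_{j=1}^{d_{in}}\sum_{k=1}^{k_1}\sum_{t=1}^{k_2}|K_{i,j,k,t}|,$$ $$\|\operatorname{conv}\|_2\le\Big(h_{out}w_{out}\sum_{i=1}^{d_{out}}\sum_{j=1}^{d_{in}}\sum_{k=1}^{k_1}\sum_{t=1}^{k_2}|K_{i,j,k,t}|^2\Big)^{1/2}.$$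
   Context: Convolutional layer. All of $d_{in},h_{in},w_{in},d_{out},k_1,k_2,s_1,s_2$ are positive integers and $p_1,p_2$ are nonnegative integers. For an input $x\in\mathbb{R}^{d_{in}\times h_{in}\times w_{in}}$, let $\tilde x\in\mathbb{R}^{d_{in}\times(h_{in}+2p_1)\times(w_{in}+2p_2)}$ be its zero-padded version: $\tilde x_{j,a,b}=x_{j,a-p_1,b-p_2}$ if $1\le a-p_1\le h_{in}$ and $1\le b-p_2\le w_{in}$, and $\tilde x_{j,a,b}=0$ otherwise. The layer is $$\operatorname{conv}(x)_{i,u,v}=\beta_i+\sum_{j=1}^{d_{in}}\sum_{k=1}^{k_1}\sum_{t=1}^{k_2}K_{i,j,k,t}\,\tilde x_{j,(u-1)s_1+k,(v-1)s_2+t}$$ for $1\le i\le d_{out}$, $1\le u\le h_{out}$, $1\le v\le w_{out}$, where $\beta_i$ is a bias, $h_{out}=\lfloor(h_{in}+2p_1-k_1)/s_1\rfloor+1$ and $w_{out}=\lfloor(w_{in}+2p_2-k_2)/s_2\rfloor+1$. Norm of the layer. After flattening the input (excluding padding) and the output into vectors, $\operatorname{conv}(x)=Mx+b$ for a matrix $M\in\mathbb{R}^{d_{out}h_{out}w_{out}\times d_{in}h_{in}w_{in}}$, called the linear transformation matrix of $\operatorname{conv}$. For $p\in\{1,2,\infty\}$, $\|\operatorname{conv}\|_p:=\|M\|_p$ is the operator norm of $M$ induced by the vector $\ell_p$ norm. The set $\mathcal{S}$. Let $\mathcal{N}:=\{(k,t)\colon 1\le k\le k_1,\ 1\le t\le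 k_2\}$. For $(a,b),(c,d)\in\mathcal{N}$ write $(a,b)\sim(c,d)$ if $a-c\equiv0\pmod{s_1}$ and $b-d\equiv0\pmod{s_2}$. For $(a,b)\in\mathcal{N}$ let $\mathcal{A}_{(a,b)}$ be the largest subset of $\mathcal{N}$ containing $(a,b)$ such that every $(c,d)\in\mathcal{A}_{(a,b)}$ satisfies $(c,d)\sim(a,b)$, $0\le c-a\le h_{in}+2p_1-k_1$ and $0\le d-b\le w_{in}+2p_2-k_2$ (i.e. the set of all such $(c,d)$). Let $\mathcal{S}:=\{\mathcal{A}_{(a,b)}\colon(a,b)\in\mathcal{N}\}$. *)

theory Defs
  imports
    "HOL-Library.Extended_Real"
    "HOL-Number_Theory.Cong"
    "Jordan_Normal_Form.Matrix"
begin

text \<open>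
  Tensors are functions of 1-based indices. Only the entries inside the index range given by the
  dimensions of a layer are relevant: neither the layer map nor the flattening below reads any
  other entry of its argument.
\<close>

type_synonym tensor3 = "nat \<Rightarrow> nat \<Rightarrow> nat \<Rightarrow> real"
type_synonym tensor4 = "nat \<Rightarrow> nat \<Rightarrow> nat \<Rightarrow> nat \<Rightarrow> real"

record conv_layer =
  d_in :: nat
  h_in :: nat
  w_in :: nat
  d_out :: nat
  k\<^sub>1 :: nat
  k\<^sub>2 :: nat
  s\<^sub>1 :: nat
  s\<^sub>2 :: nat
  p\<^sub>1 :: nat
  p\<^sub>2 :: nat
  kern :: tensor4
  bias :: "nat \<Rightarrow> real"

text \<open>
  The subtractions here and in \<open>index_class\<close> are on natural numbers; they are exact as soon as
  the kernel fits into the padded input.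
\<close>

definition h_out :: "conv_layer \<Rightarrow> nat" where
  "h_out L = (h_in L + 2 * p\<^sub>1 L - k\<^sub>1 L) div s\<^sub>1 L + 1"

definition w_out :: "conv_layer \<Rightarrow> nat" where
  "w_out L = (w_in L + 2 * p\<^sub>2 L - k\<^sub>2 L) div s\<^sub>2 L + 1"

definition zero_pad :: "conv_layer \<Rightarrow> tensor3 \<Rightarrow> tensor3" where
  "zero_pad L x j a b =
     (if 1 \<le> a - p\<^sub>1 L \<and> a - p\<^sub>1 L \<le> h_in L \<and> 1 \<le> b - p\<^sub>2 L \<and> b - p\<^sub>2 L \<le> w_in L
      then x j (a - p\<^sub>1 L) (b - p\<^sub>2 L) else 0)"

definition conv :: "conv_layer \<Rightarrow> tensor3 \<Rightarrow> tensor3" where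
  "conv L x i u v =
     bias L i +
     (\<Sum>j = 1..d_in L. \<Sum>k = 1..k\<^sub>1 L. \<Sum>t = 1..k\<^sub>2 L.
        kern L i j k t * zero_pad L x j ((u - 1) * s\<^sub>1 L + k) ((v - 1) * s\<^sub>2 L + t))"

text \<open>Row-major flattening of a \<open>d \<times> h \<times> w\<close> tensor.\<close>

definition flatten :: "nat \<Rightarrow> nat \<Rightarrow> nat \<Rightarrow> tensor3 \<Rightarrow> real vec" where
  "flatten d h w x =
     vec (d * h * w) (\<lambda>n. x (n div (h * w) + 1) (n mod (h * w) div w + 1) (n mod w + 1))"

definition represents_conv :: "real mat \<Rightarrow> conv_layer \<Rightarrow> bool" where
  "represents_conv M L \<longleftrightarrow>
     M \<in> carrier_mat (d_out L * h_out L * w_out L) (d_in L * h_in L * w_in L) \<and>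
     (\<exists>b \<in> carrier_vec (d_out L * h_out L * w_out L). \<forall>x.
        flatten (d_out L) (h_out L) (w_out L) (conv L x) =
        M *\<^sub>v flatten (d_in L) (h_in L) (w_in L) x + b)"

text \<open>Existence and uniqueness are shown in \<open>ex1_represents_conv\<close> below.\<close>

definition conv_matrix :: "conv_layer \<Rightarrow> real mat" where
  "conv_matrix L = (THE M. represents_conv M L)"

text \<open>The \<open>\<ell>\<^sub>p\<close> norm on vectors of positive dimension, for \<open>1 \<le> p \<le> \<infinity>\<close>.\<close>

definition lp_norm :: "ereal \<Rightarrow> real vec \<Rightarrow> real" where
  "lp_norm p v =
     (if p = \<infinity> then MAX i\<in>{..<dim_vec v}. \<bar>v $ i\<bar>
      else (\<Sum>i<dim_vec v. \<bar>v $ i\<bar> powr real_of_ereal p) powr (1 / real_of_ereal p))"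

definition lp_op_norm :: "ereal \<Rightarrow> real mat \<Rightarrow> real" where
  "lp_op_norm p M =
     (SUP v \<in> carrier_vec (dim_col M) - {0\<^sub>v (dim_col M)}. lp_norm p (M *\<^sub>v v) / lp_norm p v)"

definition conv_norm :: "ereal \<Rightarrow> conv_layer \<Rightarrow> real" where
  "conv_norm p L = lp_op_norm p (conv_matrix L)"

definition kernel_indices :: "conv_layer \<Rightarrow> (nat \<times> nat) set" where
  "kernel_indices L = {1..k\<^sub>1 L} \<times> {1..k\<^sub>2 L}"

definition stride_equiv :: "conv_layer \<Rightarrow> nat \<times> nat \<Rightarrow> nat \<times> nat \<Rightarrow> bool" where
  "stride_equiv L = (\<lambda>(a, b) (c, d). [a = c] (mod s\<^sub>1 L) \<and> [b = d] (mod s\<^sub>2 L))"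

definition index_class :: "conv_layer \<Rightarrow> nat \<times> nat \<Rightarrow> (nat \<times> nat) set" where
  "index_class L = (\<lambda>(a, b). {(c, d) \<in> kernel_indices L.
     stride_equiv L (c, d) (a, b) \<and>
     a \<le> c \<and> c - a \<le> h_in L + 2 * p\<^sub>1 L - k\<^sub>1 L \<and>
     b \<le> d \<and> d - b \<le> w_in L + 2 * p\<^sub>2 L - k\<^sub>2 L})"

definition index_classes :: "conv_layer \<Rightarrow> (nat \<times> nat) set set" where
  "index_classes L = index_class L ` kernel_indices L"

lemma row_major_unique:
  fixes n h w j a b :: nat
  assumes "a < h" "b < w"
  shows "n div (h * w) = j \<and> n mod (h * w) div w = a \<and> n mod w = b \<longleftrightarrow> n = (j * h + a) * w + b"
proof -
  have "n div (h * w) = n div w div h" "n mod (h * w) div w = n div w mod h"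
    using assms(2) by (simp_all add: mult.commute[of h w] div_mult2_eq mod_mult2_eq)
  moreover have "n div w div h = j \<and> n div w mod h = a \<and> n mod w = b \<longleftrightarrow> n = (j * h + a) * w + b"
  proof
    assume *: "n div w div h = j \<and> n div w mod h = a \<and> n mod w = b"
    then have "n div w = j * h + a" using div_mult_mod_eq[of "n div w" h] by simp
    with * show "n = (j * h + a) * w + b" using div_mult_mod_eq[of n w] by simp
  next
    assume n: "n = (j * h + a) * w + b"
    have "n div w = j * h + a" "n mod w = b" using assms(2) n by (simp_all add: div_add1_eq)
    then show "n div w div h = j \<and> n div w mod h = a \<and> n mod w = b"
      using assms(1) by (simp add: div_add1_eq)
  qed
  ultimately show ?thesis by simp
qed

lemma row_major_bound:
  fixes d h w j a b :: nat
  assumes "j < d" "a < h" "b < w"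
  shows "(j * h + a) * w + b < d * h * w"
proof -
  have 1: "m * q + r < M * q" if "m < M" "r < q" for m q r M :: nat
  proof -
    have "m * q + r < Suc m * q" using that by simp
    also have "\<dots> \<le> M * q" using that by (intro mult_right_mono) auto
    finally show ?thesis .
  qed
  show ?thesis using assms by (intro 1)
qed

lemma flatten_surj:
  assumes "v \<in> carrier_vec (d * h * w)"
  shows "\<exists>x. flatten d h w x = v"
proof
  let ?x = "\<lambda>j a b. v $ (((j - 1) * h + (a - 1)) * w + (b - 1))"
  show "flatten d h w ?x = v"
  proof (rule eq_vecI)
    fix n assume n: "n < dim_vec v"
    then have hw: "0 < h" "0 < w" using assms by (auto intro!: gr0I)
    let ?a = "n mod (h * w) div w" and ?b = "n mod w"
    have "?a < h" using hw by (simp add: less_mult_imp_div_less)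
    moreover have "?b < w" using hw by simp
    ultimately have "n = (n div (h * w) * h + ?a) * w + ?b"
      using row_major_unique by blast
    then show "flatten d h w ?x $ n = v $ n"
      using n assms by (simp add: flatten_def)
  qed (use assms in \<open>simp add: flatten_def\<close>)
qed

lemma zero_pad_eq_sum:
  assumes "1 \<le> j" "j \<le> d_in L"
  shows "zero_pad L x j a b = (\<Sum>n < d_in L * h_in L * w_in L.
     of_bool (n div (h_in L * w_in L) + 1 = j \<and> n mod (h_in L * w_in L) div w_in L + 1 + p\<^sub>1 L = a \<and>
              n mod w_in L + 1 + p\<^sub>2 L = b) *
     flatten (d_in L) (h_in L) (w_in L) x $ n)" (is "_ = (\<Sum>n<?N. of_bool (?P n) * ?f n)")
proof (cases "1 \<le> a - p\<^sub>1 L \<and> a - p\<^sub>1 L \<le> h_in L \<and> 1 \<le> b - p\<^sub>2 L \<and> b - p\<^sub>2 L \<le> w_in L")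
  case True
  define a' b' n where "a' = a - p\<^sub>1 L - 1" and "b' = b - p\<^sub>2 L - 1"
    and "n = ((j - 1) * h_in L + a') * w_in L + b'"
  have ab: "a' < h_in L" "b' < w_in L" "a = a' + 1 + p\<^sub>1 L" "b = b' + 1 + p\<^sub>2 L"
    using True unfolding a'_def b'_def by auto
  have n: "n < ?N" unfolding n_def using assms ab by (intro row_major_bound) auto
  have P: "?P m \<longleftrightarrow> m = n" for m
    using row_major_unique[OF ab(1,2), of m "j - 1"] assms ab(3,4) unfolding n_def by auto
  have "?P n" using P by simp
  then have "?f n = zero_pad L x j a b"
    using True n by (auto simp: flatten_def zero_pad_def)
  moreover have "(\<Sum>m<?N. of_bool (?P m) * ?f m) = (\<Sum>m<?N. if m = n then ?f m else 0)"
    unfolding P by (intro sum.cong) auto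
  ultimately show ?thesis using n by simp
next
  case False
  have "of_bool (?P n) * ?f n = 0" if "n < ?N" for n
  proof -
    have "0 < h_in L" "0 < w_in L" using that by (auto intro!: gr0I)
    then have "n mod (h_in L * w_in L) div w_in L < h_in L" "n mod w_in L < w_in L"
      by (simp_all add: less_mult_imp_div_less)
    then show ?thesis using False by auto
  qed
  moreover have "zero_pad L x j a b = 0" using False by (auto simp: zero_pad_def)
  ultimately show ?thesis by (simp del: mult_eq_0_iff)
qed

lemma ex1_represents_conv: "\<exists>!M. represents_conv M L"
proof (rule ex_ex1I)
  let ?m = "d_out L * h_out L * w_out L" and ?n = "d_in L * h_in L * w_in L"
  let ?fi = "flatten (d_in L) (h_in L) (w_in L)" and ?fo = "flatten (d_out L) (h_out L) (w_out L)"
  define I where "I r = r div (h_out L * w_out L) + 1" for r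
  define U where "U r = r mod (h_out L * w_out L) div w_out L + 1" for r
  define V where "V r = r mod w_out L + 1" for r
  define P where "P r j k t n \<longleftrightarrow> n div (h_in L * w_in L) + 1 = j \<and>
      n mod (h_in L * w_in L) div w_in L + 1 + p\<^sub>1 L = (U r - 1) * s\<^sub>1 L + k \<and>
      n mod w_in L + 1 + p\<^sub>2 L = (V r - 1) * s\<^sub>2 L + t" for r j k t n
  define M where "M = mat ?m ?n (\<lambda>(r, n). \<Sum>j = 1..d_in L. \<Sum>k = 1..k\<^sub>1 L. \<Sum>t = 1..k\<^sub>2 L.
      kern L (I r) j k t * of_bool (P r j k t n))"
  define b where "b = vec ?m (\<lambda>r. bias L (I r))"
  have "?fo (conv L x) = M *\<^sub>v ?fi x + b" for x
  proof (rule eq_vecI)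
    fix r assume "r < dim_vec (M *\<^sub>v ?fi x + b)"
    then have r: "r < ?m" by (simp add: b_def)
    have dim: "dim_vec (?fi x) = ?n" by (simp add: flatten_def)
    have "(M *\<^sub>v ?fi x) $ r = (\<Sum>n<?n. (\<Sum>j = 1..d_in L. \<Sum>k = 1..k\<^sub>1 L. \<Sum>t = 1..k\<^sub>2 L.
        kern L (I r) j k t * of_bool (P r j k t n)) * ?fi x $ n)"
      using r by (simp add: M_def scalar_prod_def dim atLeast0LessThan)
    also have "\<dots> = (\<Sum>j = 1..d_in L. \<Sum>k = 1..k\<^sub>1 L. \<Sum>t = 1..k\<^sub>2 L. \<Sum>n<?n.
        kern L (I r) j k t * (of_bool (P r j k t n) * ?fi x $ n))"
      unfolding sum_distrib_right mult.assoc[where 'a = real]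
      by (simp only: sum.swap[where A = "{..<?n}"])
    also have "\<dots> = (\<Sum>j = 1..d_in L. \<Sum>k = 1..k\<^sub>1 L. \<Sum>t = 1..k\<^sub>2 L. kern L (I r) j k t *
        zero_pad L x j ((U r - 1) * s\<^sub>1 L + k) ((V r - 1) * s\<^sub>2 L + t))"
      unfolding sum_distrib_left[symmetric] P_def
      by (intro sum.cong refl, subst zero_pad_eq_sum) auto
    finally show "?fo (conv L x) $ r = (M *\<^sub>v ?fi x + b) $ r"
      using r by (simp add: flatten_def conv_def b_def I_def U_def V_def)
  qed (simp add: flatten_def b_def)
  then have "represents_conv M L"
    unfolding represents_conv_def
    by (intro conjI bexI[of _ b] allI) (auto simp: M_def b_def)
  then show "\<exists>M. represents_conv M L" ..
next
  let ?m = "d_out L * h_out L * w_out L" and ?n = "d_in L * h_in L * w_in L"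
  let ?fi = "flatten (d_in L) (h_in L) (w_in L)" and ?fo = "flatten (d_out L) (h_out L) (w_out L)"
  fix M M' assume "represents_conv M L" "represents_conv M' L"
  then obtain b b' where M: "M \<in> carrier_mat ?m ?n" "M' \<in> carrier_mat ?m ?n"
    and b: "b \<in> carrier_vec ?m" "b' \<in> carrier_vec ?m"
    and "\<And>x. ?fo (conv L x) = M *\<^sub>v ?fi x + b" "\<And>x. ?fo (conv L x) = M' *\<^sub>v ?fi x + b'"
    unfolding represents_conv_def by blast
  then have eq: "M *\<^sub>v v + b = M' *\<^sub>v v + b'" if "v \<in> carrier_vec ?n" for v
    using flatten_surj[OF that] by metis
  have z: "A *\<^sub>v 0\<^sub>v ?n = 0\<^sub>v ?m" if "A \<in> carrier_mat ?m ?n" for A :: "real mat"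
    using that by (intro eq_vecI) auto
  have "b = b'" using eq[of "0\<^sub>v ?n"] b z[OF M(1)] z[OF M(2)] by simp
  have col: "col M c = col M' c" if "c < ?n" for c
  proof -
    have "M *\<^sub>v unit_vec ?n c + b = M' *\<^sub>v unit_vec ?n c + b"
      using eq[of "unit_vec ?n c"] \<open>b = b'\<close> by simp
    then have "\<And>r. r < ?m \<Longrightarrow> (M *\<^sub>v unit_vec ?n c) $ r = (M' *\<^sub>v unit_vec ?n c) $ r"
      using b M by (metis add_right_cancel carrier_matD(1) carrier_vecD dim_mult_mat_vec index_add_vec(1))
    then show ?thesis using M that by (intro eq_vecI) auto
  qed
  show "M = M'" using M col by (intro mat_col_eqI) auto
qed

end

(* Each matrix entry is zero or a single kernel entry, so the 1- and infinity-norms are maximal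
   absolute column and row sums, and the 2-norm is bounded by the Frobenius norm.
   Every row contains a subset of one filter, and the row of output position (c1, c2) contains all
   of it, because there the kernel avoids the padding. The kernel entries in a column form a product
   of two one-dimensional index sets; these sets and the one-dimensional index classes have the same
   maximal members, since the size assumption allows shifting a class out of the padding by a
   multiple of the stride. *)

theory Submission
  imports Defs "HOL-Analysis.Convex"
begin

section \<open>Operator norms of real matrices\<close>

lemma lp_norm_1: "lp_norm 1 v = (\<Sum>i<dim_vec v. \<bar>v $ i\<bar>)"
proof -
  have "(1::ereal) \<noteq> \<infinity>" by simp
  then show ?thesis by (simp add: lp_norm_def sum_nonneg)
qed

lemma lp_norm_2: "lp_norm 2 v = sqrt (\<Sum>i<dim_vec v. (v $ i)\<^sup>2)"
proof -
  have "(2::ereal) \<noteq> \<infinity>" "real_of_ereal 2 = 2" by simp_all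
  then show ?thesis by (simp add: lp_norm_def powr_half_sqrt sum_nonneg)
qed

lemma lp_norm_inf: "lp_norm \<infinity> v = (MAX i\<in>{..<dim_vec v}. \<bar>v $ i\<bar>)"
  by (simp add: lp_norm_def)

lemma abs_le_lp_norm_inf: "i < dim_vec v \<Longrightarrow> \<bar>v $ i\<bar> \<le> lp_norm \<infinity> v"
  by (simp add: lp_norm_inf)

lemma lp_norm_inf_le:
  assumes "0 < dim_vec v" "\<And>i. i < dim_vec v \<Longrightarrow> \<bar>v $ i\<bar> \<le> C"
  shows "lp_norm \<infinity> v \<le> C"
  unfolding lp_norm_inf using assms by (subst Max_le_iff) auto

lemma nonzero_vec_entry:
  assumes "v \<in> carrier_vec n - {0\<^sub>v n}"
  obtains i where "i < dim_vec v" "v $ i \<noteq> 0"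
proof -
  have "\<exists>i<dim_vec v. v $ i \<noteq> 0"
  proof (rule ccontr)
    assume "\<not> ?thesis"
    then have "v = 0\<^sub>v n" using assms by (intro eq_vecI) auto
    then show False using assms by simp
  qed
  then show ?thesis using that by blast
qed

text \<open>This lets bounds on the quotients in \<open>lp_op_norm\<close> be cleared of their
  denominators.\<close>

lemma lp_norm_pos:
  assumes "v \<in> carrier_vec n - {0\<^sub>v n}" "p \<in> {1, 2, \<infinity>}"
  shows "0 < lp_norm p v"
proof -
  obtain i where i: "i < dim_vec v" "v $ i \<noteq> 0"
    using nonzero_vec_entry[OF assms(1)] .
  have "0 < lp_norm 1 v"
    unfolding lp_norm_1 using i by (intro sum_pos2[of _ i]) auto
  moreover have "0 < lp_norm 2 v"
    unfolding lp_norm_2 real_sqrt_gt_0_iff using i by (intro sum_pos2[of _ i]) auto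
  moreover have "0 < lp_norm \<infinity> v"
    using abs_le_lp_norm_inf[OF i(1)] i(2) by linarith
  ultimately show ?thesis using assms(2) by blast
qed

lemma unit_vec_in_nonzero:
  assumes "c < n"
  shows "unit_vec n c \<in> carrier_vec n - {0\<^sub>v n :: real vec}"
  using assms by simp

text \<open>Positive dimension provides a unit vector, so that the real supremum is taken over a
  nonempty set.\<close>

lemma lp_op_norm_le:
  assumes "0 < dim_col M" "p \<in> {1, 2, \<infinity>}"
    and "\<And>v. v \<in> carrier_vec (dim_col M) \<Longrightarrow> lp_norm p (M *\<^sub>v v) \<le> C * lp_norm p v"
  shows "lp_op_norm p M \<le> C"
  unfolding lp_op_norm_def
proof (rule cSUP_least)
  show "carrier_vec (dim_col M) - {0\<^sub>v (dim_col M) :: real vec} \<noteq> {}"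
    using unit_vec_in_nonzero[OF assms(1)] by blast
next
  fix v :: "real vec" assume v: "v \<in> carrier_vec (dim_col M) - {0\<^sub>v (dim_col M)}"
  have "lp_norm p (M *\<^sub>v v) \<le> C * lp_norm p v" using assms(3) v by simp
  then show "lp_norm p (M *\<^sub>v v) / lp_norm p v \<le> C"
    using lp_norm_pos[OF v assms(2)] by (simp add: divide_le_eq)
qed

text \<open>A bound attained at some \<open>w\<close> is the maximum of the quotients, hence their
  supremum; boundedness and nonemptiness come for free.\<close>

lemma lp_op_norm_eqI:
  assumes "p \<in> {1, 2, \<infinity>}"
    and "\<And>v. v \<in> carrier_vec (dim_col M) \<Longrightarrow> lp_norm p (M *\<^sub>v v) \<le> C * lp_norm p v"
    and "w \<in> carrier_vec (dim_col M) - {0\<^sub>v (dim_col M)}"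
    and "C * lp_norm p w \<le> lp_norm p (M *\<^sub>v w)"
  shows "lp_op_norm p M = C"
  unfolding lp_op_norm_def
proof (rule cSup_eq_maximum)
  have "lp_norm p (M *\<^sub>v w) = C * lp_norm p w"
    using assms by (intro antisym) auto
  then have "C = lp_norm p (M *\<^sub>v w) / lp_norm p w"
    using lp_norm_pos[OF assms(3,1)] by simp
  then show "C \<in> (\<lambda>v. lp_norm p (M *\<^sub>v v) / lp_norm p v) `
      (carrier_vec (dim_col M) - {0\<^sub>v (dim_col M)})"
    using assms(3) by (rule image_eqI)
next
  fix x assume "x \<in> (\<lambda>v. lp_norm p (M *\<^sub>v v) / lp_norm p v) `
      (carrier_vec (dim_col M) - {0\<^sub>v (dim_col M)})"
  then obtain v where v: "v \<in> carrier_vec (dim_col M) - {0\<^sub>v (dim_col M)}"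
    "x = lp_norm p (M *\<^sub>v v) / lp_norm p v" by blast
  then show "x \<le> C"
    using assms(2)[of v] lp_norm_pos[OF v(1) assms(1)] by (simp add: divide_le_eq)
qed

section \<open>Induced 1-norm and infinity-norm, and the Frobenius bound\<close>

lemma mult_mat_vec_index:
  assumes "i < dim_row M" "v \<in> carrier_vec (dim_col M)"
  shows "(M *\<^sub>v v) $ i = (\<Sum>n<dim_col M. M $$ (i, n) * v $ n)"
  using assms by (simp add: scalar_prod_def atLeast0LessThan)

lemma abs_mult_mat_vec_le:
  fixes M :: "real mat"
  assumes "i < dim_row M" "v \<in> carrier_vec (dim_col M)"
  shows "\<bar>(M *\<^sub>v v) $ i\<bar> \<le> (\<Sum>n<dim_col M. \<bar>M $$ (i, n)\<bar> * \<bar>v $ n\<bar>)"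
  unfolding mult_mat_vec_index[OF assms]
  by (rule order_trans[OF sum_abs]) (simp add: abs_mult)

text \<open>Swapping the two sums gives the upper bound, and the unit vector of the maximal column
  \<open>m\<close> attains it.\<close>

lemma lp_op_norm_1_eqI:
  fixes M :: "real mat"
  assumes le: "\<And>n. n < dim_col M \<Longrightarrow> (\<Sum>r<dim_row M. \<bar>M $$ (r, n)\<bar>) \<le> C"
    and m: "m < dim_col M" "C \<le> (\<Sum>r<dim_row M. \<bar>M $$ (r, m)\<bar>)"
  shows "lp_op_norm 1 M = C"
proof (rule lp_op_norm_eqI)
  fix v :: "real vec" assume v: "v \<in> carrier_vec (dim_col M)"
  have "(\<Sum>r<dim_row M. \<bar>(M *\<^sub>v v) $ r\<bar>)
      \<le> (\<Sum>r<dim_row M. \<Sum>n<dim_col M. \<bar>M $$ (r, n)\<bar> * \<bar>v $ n\<bar>)"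
    by (intro sum_mono abs_mult_mat_vec_le v) auto
  also have "\<dots> = (\<Sum>n<dim_col M. (\<Sum>r<dim_row M. \<bar>M $$ (r, n)\<bar>) * \<bar>v $ n\<bar>)"
    unfolding sum_distrib_right by (rule sum.swap)
  also have "\<dots> \<le> (\<Sum>n<dim_col M. C * \<bar>v $ n\<bar>)"
    by (intro sum_mono mult_right_mono le) auto
  finally show "lp_norm 1 (M *\<^sub>v v) \<le> C * lp_norm 1 v"
    using v by (simp add: lp_norm_1 sum_distrib_left)
next
  have "(\<Sum>n<dim_col M. \<bar>unit_vec (dim_col M) m $ n :: real\<bar>)
      = (\<Sum>n<dim_col M. if n = m then 1 else 0)"
    using m(1) by (intro sum.cong) (auto simp: unit_vec_def)
  then show "C * lp_norm 1 (unit_vec (dim_col M) m) \<le> lp_norm 1 (M *\<^sub>v unit_vec (dim_col M) m)"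
    using m by (simp add: lp_norm_1)
qed (use m unit_vec_in_nonzero in auto)

text \<open>The bound holds entry by entry and is attained at the sign vector of the maximal row
  \<open>m\<close>.\<close>

lemma lp_op_norm_inf_eqI:
  fixes M :: "real mat"
  assumes le: "\<And>r. r < dim_row M \<Longrightarrow> (\<Sum>n<dim_col M. \<bar>M $$ (r, n)\<bar>) \<le> C"
    and m: "m < dim_row M" "C \<le> (\<Sum>n<dim_col M. \<bar>M $$ (m, n)\<bar>)"
    and "0 < dim_col M"
  shows "lp_op_norm \<infinity> M = C"
proof (rule lp_op_norm_eqI)
  fix v :: "real vec" assume v: "v \<in> carrier_vec (dim_col M)"
  have pos: "0 \<le> lp_norm \<infinity> v"
    using abs_le_lp_norm_inf[of 0 v] v assms(4) by fastforce
  show "lp_norm \<infinity> (M *\<^sub>v v) \<le> C * lp_norm \<infinity> v"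
  proof (rule lp_norm_inf_le)
    fix r assume "r < dim_vec (M *\<^sub>v v)"
    then have r: "r < dim_row M" by simp
    have "\<bar>(M *\<^sub>v v) $ r\<bar> \<le> (\<Sum>n<dim_col M. \<bar>M $$ (r, n)\<bar> * \<bar>v $ n\<bar>)"
      using r v by (rule abs_mult_mat_vec_le)
    also have "\<dots> \<le> (\<Sum>n<dim_col M. \<bar>M $$ (r, n)\<bar> * lp_norm \<infinity> v)"
      using v by (intro sum_mono mult_left_mono abs_le_lp_norm_inf) auto
    also have "\<dots> \<le> C * lp_norm \<infinity> v"
      unfolding sum_distrib_right[symmetric] by (intro mult_right_mono le r pos)
    finally show "\<bar>(M *\<^sub>v v) $ r\<bar> \<le> C * lp_norm \<infinity> v" .
  qed (use m in simp)
next
  \<comment> \<open>All products in entry \<open>m\<close> of the image become absolute values. Zero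
    entries get sign 1, so \<open>w\<close> is nonzero even if the row vanishes.\<close>
  define w :: "real vec" where
    "w = vec (dim_col M) (\<lambda>n. if 0 \<le> M $$ (m, n) then 1 else -1)"
  have w: "w \<in> carrier_vec (dim_col M)" by (simp add: w_def)
  have "w $ 0 \<noteq> 0" using assms(4) by (simp add: w_def)
  then show "w \<in> carrier_vec (dim_col M) - {0\<^sub>v (dim_col M)}"
    using w assms(4) by auto
  have "lp_norm \<infinity> w \<le> 1"
    using assms(4) by (intro lp_norm_inf_le) (auto simp: w_def)
  moreover have "0 \<le> C"
    using le[OF m(1)] by (rule order_trans[OF sum_nonneg, rotated]) simp
  ultimately have "C * lp_norm \<infinity> w \<le> C" by (simp add: mult_left_le)
  also have "\<dots> \<le> (\<Sum>n<dim_col M. \<bar>M $$ (m, n)\<bar>)" by (rule m)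
  also have "\<dots> = (M *\<^sub>v w) $ m"
    unfolding mult_mat_vec_index[OF m(1) w] by (intro sum.cong) (auto simp: w_def)
  also have "\<dots> \<le> lp_norm \<infinity> (M *\<^sub>v w)"
    using abs_le_lp_norm_inf[of m "M *\<^sub>v w"] m(1) by simp
  finally show "C * lp_norm \<infinity> w \<le> lp_norm \<infinity> (M *\<^sub>v w)" .
qed simp

text \<open>Cauchy-Schwarz is applied to each row and the results are added up.\<close>

lemma lp_op_norm_2_le_frobenius:
  fixes M :: "real mat"
  assumes "0 < dim_col M"
  shows "lp_op_norm 2 M \<le> sqrt (\<Sum>r<dim_row M. \<Sum>n<dim_col M. (M $$ (r, n))\<^sup>2)"
proof (rule lp_op_norm_le)
  fix v :: "real vec" assume v: "v \<in> carrier_vec (dim_col M)"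
  have "((M *\<^sub>v v) $ r)\<^sup>2 \<le> (\<Sum>n<dim_col M. (M $$ (r, n))\<^sup>2) * (\<Sum>n<dim_col M. (v $ n)\<^sup>2)"
    if "r < dim_row M" for r
    unfolding mult_mat_vec_index[OF that v] by (rule Cauchy_Schwarz_ineq_sum)
  then have "(\<Sum>r<dim_row M. ((M *\<^sub>v v) $ r)\<^sup>2)
      \<le> (\<Sum>r<dim_row M. \<Sum>n<dim_col M. (M $$ (r, n))\<^sup>2) * (\<Sum>n<dim_col M. (v $ n)\<^sup>2)"
    unfolding sum_distrib_right by (intro sum_mono) auto
  then show "lp_norm 2 (M *\<^sub>v v)
      \<le> sqrt (\<Sum>r<dim_row M. \<Sum>n<dim_col M. (M $$ (r, n))\<^sup>2) * lp_norm 2 v"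
    unfolding lp_norm_2 using v by (simp flip: real_sqrt_mult)
qed (use assms in auto)


section \<open>Sums over flattened indices and indicator sums\<close>

lemma row_major_index_bounds:
  fixes d h w n :: nat
  assumes "n < d * h * w"
  shows "n div (h * w) < d" "n mod (h * w) div w < h" "n mod w < w"
proof -
  have "0 < h" "0 < w" using assms by (auto intro!: gr0I)
  then show "n mod (h * w) div w < h" "n mod w < w"
    by (simp_all add: less_mult_imp_div_less)
  show "n div (h * w) < d" using assms by (simp add: less_mult_imp_div_less mult.assoc)
qed

text \<open>Row-major numbering is a bijection; this turns sums over matrix rows or columns into
  sums over tensor positions.\<close>

lemma sum_row_major:
  fixes d h w :: nat and f :: "nat \<Rightarrow> nat \<Rightarrow> nat \<Rightarrow> 'a :: comm_monoid_add"
  shows "(\<Sum>n<d * h * w. f (n div (h * w)) (n mod (h * w) div w) (n mod w))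
       = (\<Sum>j<d. \<Sum>a<h. \<Sum>b<w. f j a b)"
proof -
  have "(\<Sum>n<d * h * w. f (n div (h * w)) (n mod (h * w) div w) (n mod w))
      = (\<Sum>(j, a, b)\<in>{..<d} \<times> {..<h} \<times> {..<w}. f j a b)"
  proof (rule sum.reindex_bij_witness[where
        i = "\<lambda>(j, a, b). (j * h + a) * w + b" and
        j = "\<lambda>n. (n div (h * w), n mod (h * w) div w, n mod w)"])
    fix n assume "n \<in> {..<d * h * w}"
    then have n: "n div (h * w) < d" "n mod (h * w) div w < h" "n mod w < w"
      using row_major_index_bounds by simp_all
    then show "(case (n div (h * w), n mod (h * w) div w, n mod w) of
        (j, a, b) \<Rightarrow> (j * h + a) * w + b) = n"
      using row_major_unique[OF n(2,3)] by (metis case_prod_conv)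
    show "(n div (h * w), n mod (h * w) div w, n mod w) \<in> {..<d} \<times> {..<h} \<times> {..<w}"
      using n by simp
  next
    fix x assume "x \<in> {..<d} \<times> {..<h} \<times> {..<w}"
    then obtain j a b where x: "x = (j, a, b)" "j < d" "a < h" "b < w" by auto
    show "(case x of (j, a, b) \<Rightarrow> (j * h + a) * w + b) \<in> {..<d * h * w}"
      using row_major_bound[OF x(2-4)] by (simp add: x(1))
    show "(\<lambda>n. (n div (h * w), n mod (h * w) div w, n mod w))
        (case x of (j, a, b) \<Rightarrow> (j * h + a) * w + b) = x"
      using row_major_unique[OF x(3,4), of "(j * h + a) * w + b" j] by (simp add: x(1))
  qed simp
  then show ?thesis by (simp add: sum.cartesian_product)
qed

section \<open>Factoring sums, and indicator sums with at most one nonzero term\<close>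

lemma sum_mult_sum_mult_sum:
  fixes f g h :: "_ \<Rightarrow> 'a :: semiring_0"
  shows "(\<Sum>i\<in>A. f i) * ((\<Sum>u\<in>B. g u) * (\<Sum>v\<in>C. h v)) =
    (\<Sum>i\<in>A. \<Sum>u\<in>B. \<Sum>v\<in>C. f i * (g u * h v))"
  unfolding sum_product by (simp only: sum_distrib_left)

text \<open>The sum is a single \<open>f x\<close> or 0, so \<open>g\<close> may be any function
  fixing 0; no additivity is involved.\<close>

lemma apply_sum_of_bool_unique:
  fixes f :: "'a \<Rightarrow> 'b :: semiring_1" and g :: "'b \<Rightarrow> 'c :: semiring_1"
  assumes "finite S" "\<And>x y. x \<in> S \<Longrightarrow> y \<in> S \<Longrightarrow> P x \<Longrightarrow> P y \<Longrightarrow> x = y" "g 0 = 0"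
  shows "g (\<Sum>x\<in>S. f x * of_bool (P x)) = (\<Sum>x\<in>S. g (f x) * of_bool (P x))"
proof (cases "\<exists>x\<in>S. P x")
  case True
  then obtain x where x: "x \<in> S" "P x" by blast
  \<comment> \<open>Polymorphic in the codomain, since it serves both \<open>f\<close> and the
    composition of \<open>g\<close> with \<open>f\<close>.\<close>
  have eq: "(\<Sum>y\<in>S. h y * of_bool (P y)) = h x" for h :: "'a \<Rightarrow> 'd :: semiring_1"
  proof -
    have "(\<Sum>y\<in>S. h y * of_bool (P y)) = (\<Sum>y\<in>S. if y = x then h y else 0)"
      using assms(2) x by (intro sum.cong) auto
    then show ?thesis using assms(1) x(1) by simp
  qed
  show ?thesis by (simp only: eq)
next
  case False
  then show ?thesis using assms(3) by simp
qed

lemma sum_of_bool_unique: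
  assumes "finite S" "\<And>x y. x \<in> S \<Longrightarrow> y \<in> S \<Longrightarrow> P x \<Longrightarrow> P y \<Longrightarrow> x = y"
  shows "(\<Sum>x\<in>S. of_bool (P x)) = (of_bool (\<exists>x\<in>S. P x) :: 'a :: semiring_1)"
proof (cases "\<exists>x\<in>S. P x")
  case True
  then obtain x where x: "x \<in> S" "P x" by blast
  have "(\<Sum>y\<in>S. of_bool (P y)) = (\<Sum>y\<in>S. if y = x then 1 else (0::'a))"
    using assms(2) x by (intro sum.cong) auto
  then show ?thesis using assms(1) x by auto
qed auto


section \<open>The matrix of a convolutional layer\<close>

lemma sum_kernel_indices:
  "(\<Sum>x\<in>kernel_indices L. f x) = (\<Sum>k = 1..k\<^sub>1 L. \<Sum>t = 1..k\<^sub>2 L. f (k, t))"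
  by (simp add: kernel_indices_def sum.cartesian_product)

text \<open>The matrix entry at output position \<open>(i, u, v)\<close> and input position \<open>(j, y, z)\<close>, with 0-based
  indices throughout (\<open>kern\<close> is 1-based). At most one summand is nonzero, so
  applying \<open>\<bar>\<cdot>\<bar>\<close> or squaring commutes with the sum.\<close>

definition conv_entry :: "conv_layer \<Rightarrow> nat \<Rightarrow> nat \<Rightarrow> nat \<Rightarrow> nat \<Rightarrow> nat \<Rightarrow> nat \<Rightarrow> real" where
  "conv_entry L i u v j y z = (\<Sum>(k, t)\<in>kernel_indices L. kern L (i + 1) (j + 1) k t *
     of_bool (u * s\<^sub>1 L + k = y + 1 + p\<^sub>1 L \<and> v * s\<^sub>2 L + t = z + 1 + p\<^sub>2 L))"

lemma conv_matrix_carrier: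
  "conv_matrix L \<in> carrier_mat (d_out L * h_out L * w_out L) (d_in L * h_in L * w_in L)"
  and represents_conv_matrix: "represents_conv (conv_matrix L) L"
proof -
  show "represents_conv (conv_matrix L) L"
    unfolding conv_matrix_def by (rule theI'[OF ex1_represents_conv])
  then show "conv_matrix L \<in> carrier_mat (d_out L * h_out L * w_out L) (d_in L * h_in L * w_in L)"
    by (simp add: represents_conv_def)
qed

text \<open>The columns are read off by evaluating the layer at the unit tensors and at zero.\<close>

lemma conv_matrix_index:
  assumes r: "r < d_out L * h_out L * w_out L" and n: "n < d_in L * h_in L * w_in L"
  shows "conv_matrix L $$ (r, n) =
    conv_entry L (r div (h_out L * w_out L)) (r mod (h_out L * w_out L) div w_out L) (r mod w_out L)
      (n div (h_in L * w_in L)) (n mod (h_in L * w_in L) div w_in L) (n mod w_in L)"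
proof -
  let ?M = "conv_matrix L"
  let ?m = "d_out L * h_out L * w_out L" and ?n = "d_in L * h_in L * w_in L"
  let ?fi = "flatten (d_in L) (h_in L) (w_in L)" and ?fo = "flatten (d_out L) (h_out L) (w_out L)"
  define j y z where "j = n div (h_in L * w_in L)" and "y = n mod (h_in L * w_in L) div w_in L"
    and "z = n mod w_in L"
  define i u v where "i = r div (h_out L * w_out L)" and "u = r mod (h_out L * w_out L) div w_out L"
    and "v = r mod w_out L"
  have jyz: "j < d_in L" "y < h_in L" "z < w_in L"
    unfolding j_def y_def z_def using row_major_index_bounds[OF n] by auto
  define e :: tensor3 where "e = (\<lambda>j' a b. of_bool (j' = j + 1 \<and> a = y + 1 \<and> b = z + 1))"
  obtain b where b: "b \<in> carrier_vec ?m" "\<And>x. ?fo (conv L x) = ?M *\<^sub>v ?fi x + b"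
    using represents_conv_matrix unfolding represents_conv_def by blast
  have M: "dim_row ?M = ?m" "dim_col ?M = ?n" using conv_matrix_carrier by auto
  have diff: "conv L x (i + 1) (u + 1) (v + 1) = (?M *\<^sub>v ?fi x) $ r + b $ r" for x
    using arg_cong[OF b(2)[of x], of "\<lambda>w. w $ r"] b(1) r M
    by (simp add: flatten_def i_def u_def v_def)
  have "?fi e = unit_vec ?n n"
  proof (rule eq_vecI)
    fix m assume "m < dim_vec (unit_vec ?n n)"
    then have m: "m < ?n" by simp
    have "m div (h_in L * w_in L) = j \<and> m mod (h_in L * w_in L) div w_in L = y \<and> m mod w_in L = z
        \<longleftrightarrow> m = n"
      using row_major_unique[OF jyz(2,3)] j_def y_def z_def by metis
    then show "?fi e $ m = unit_vec ?n n $ m"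
      using m n by (auto simp: flatten_def e_def)
  qed (simp add: flatten_def)
  moreover have "?fi (\<lambda>_ _ _. 0) = 0\<^sub>v ?n" by (intro eq_vecI) (auto simp: flatten_def)
  \<comment> \<open>Subtracting the value at the zero tensor cancels both \<open>b\<close> and the
    bias.\<close>
  ultimately have "?M $$ (r, n) = conv L e (i + 1) (u + 1) (v + 1)
      - conv L (\<lambda>_ _ _. 0) (i + 1) (u + 1) (v + 1)"
    unfolding diff using r n M by (simp add: scalar_prod_def[of _ "0\<^sub>v ?n"])
  also have "\<dots> = (\<Sum>j' = 1..d_in L. \<Sum>k = 1..k\<^sub>1 L. \<Sum>t = 1..k\<^sub>2 L. kern L (i + 1) j' k t *
      zero_pad L e j' (u * s\<^sub>1 L + k) (v * s\<^sub>2 L + t))"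
    by (simp add: conv_def zero_pad_def)
  also have "\<dots> = (\<Sum>j' = 1..d_in L. if j' = j + 1 then
      (\<Sum>k = 1..k\<^sub>1 L. \<Sum>t = 1..k\<^sub>2 L. kern L (i + 1) (j + 1) k t *
      of_bool (u * s\<^sub>1 L + k = y + 1 + p\<^sub>1 L \<and> v * s\<^sub>2 L + t = z + 1 + p\<^sub>2 L)) else 0)"
  proof (intro sum.cong refl)
    \<comment> \<open>Truncated subtraction causes no false match:
      \<open>a - p\<^sub>1 L = y + 1\<close> is positive, so it forces
      \<open>a = y + 1 + p\<^sub>1 L\<close>.\<close>
    have pad: "zero_pad L e j' a c = of_bool (j' = j + 1 \<and> a = y + 1 + p\<^sub>1 L \<and> c = z + 1 + p\<^sub>2 L)"
      for j' a c
      using jyz by (auto simp: zero_pad_def e_def)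
    fix j'
    show "(\<Sum>k = 1..k\<^sub>1 L. \<Sum>t = 1..k\<^sub>2 L. kern L (i + 1) j' k t *
          zero_pad L e j' (u * s\<^sub>1 L + k) (v * s\<^sub>2 L + t)) = (if j' = j + 1 then
      (\<Sum>k = 1..k\<^sub>1 L. \<Sum>t = 1..k\<^sub>2 L. kern L (i + 1) (j + 1) k t *
      of_bool (u * s\<^sub>1 L + k = y + 1 + p\<^sub>1 L \<and> v * s\<^sub>2 L + t = z + 1 + p\<^sub>2 L)) else 0)"
      unfolding pad by (cases "j' = j + 1") simp_all
  qed
  also have "\<dots> = conv_entry L i u v j y z"
    using jyz(1) by (simp add: conv_entry_def sum_kernel_indices)
  finally show ?thesis unfolding i_def u_def v_def j_def y_def z_def .
qed

text \<open>The input and output positions determine \<open>(k, t)\<close>, so at most one term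
  survives. The indicator is split into two factors so that later sums over the two directions
  separate.\<close>

lemma apply_conv_entry:
  assumes "g 0 = (0::real)"
  shows "g (conv_entry L i u v j y z) = (\<Sum>(k, t)\<in>kernel_indices L. g (kern L (i + 1) (j + 1) k t) *
     (of_bool (u * s\<^sub>1 L + k = y + 1 + p\<^sub>1 L) * of_bool (v * s\<^sub>2 L + t = z + 1 + p\<^sub>2 L)))"
proof -
  have "g (conv_entry L i u v j y z) =
    g (\<Sum>x\<in>kernel_indices L. kern L (i + 1) (j + 1) (fst x) (snd x) *
     of_bool (u * s\<^sub>1 L + fst x = y + 1 + p\<^sub>1 L \<and> v * s\<^sub>2 L + snd x = z + 1 + p\<^sub>2 L))"
    by (simp add: conv_entry_def case_prod_unfold)
  also have "\<dots> = (\<Sum>x\<in>kernel_indices L. g (kern L (i + 1) (j + 1) (fst x) (snd x)) *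
     of_bool (u * s\<^sub>1 L + fst x = y + 1 + p\<^sub>1 L \<and> v * s\<^sub>2 L + snd x = z + 1 + p\<^sub>2 L))"
    using assms by (intro apply_sum_of_bool_unique) (auto simp: kernel_indices_def)
  finally show ?thesis by (simp add: case_prod_unfold of_bool_conj)
qed

section \<open>Row and column sums of a function of the matrix entries\<close>

lemma ex_less_bex: "(\<exists>x<(n::nat). P x) \<longleftrightarrow> (\<exists>x\<in>{..<n}. P x)" by auto

text \<open>An output position and a kernel position determine at most one input position, so the
  input sums collapse to indicators of not falling on the padding.\<close>

lemma conv_matrix_row_sum:
  assumes r: "r < d_out L * h_out L * w_out L" and g: "g 0 = (0::real)"
  defines "i \<equiv> r div (h_out L * w_out L)"
    and "u \<equiv> r mod (h_out L * w_out L) div w_out L" and "v \<equiv> r mod w_out L"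
  shows "(\<Sum>n<d_in L * h_in L * w_in L. g (conv_matrix L $$ (r, n))) =
    (\<Sum>j = 1..d_in L. \<Sum>k = 1..k\<^sub>1 L. \<Sum>t = 1..k\<^sub>2 L. g (kern L (i + 1) j k t) *
      (of_bool (\<exists>y<h_in L. u * s\<^sub>1 L + k = y + 1 + p\<^sub>1 L) *
       of_bool (\<exists>z<w_in L. v * s\<^sub>2 L + t = z + 1 + p\<^sub>2 L)))"
proof -
  have "(\<Sum>n<d_in L * h_in L * w_in L. g (conv_matrix L $$ (r, n))) =
    (\<Sum>n<d_in L * h_in L * w_in L. g (conv_entry L i u v
      (n div (h_in L * w_in L)) (n mod (h_in L * w_in L) div w_in L) (n mod w_in L)))"
    using conv_matrix_index[OF r] by (simp add: i_def u_def v_def)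
  also have "\<dots> = (\<Sum>j<d_in L. \<Sum>y<h_in L. \<Sum>z<w_in L. g (conv_entry L i u v j y z))"
    by (rule sum_row_major)
  also have "\<dots> = (\<Sum>j<d_in L. \<Sum>x\<in>kernel_indices L. \<Sum>y<h_in L. \<Sum>z<w_in L.
      g (kern L (i + 1) (j + 1) (fst x) (snd x)) *
      (of_bool (u * s\<^sub>1 L + fst x = y + 1 + p\<^sub>1 L) * of_bool (v * s\<^sub>2 L + snd x = z + 1 + p\<^sub>2 L)))"
    unfolding apply_conv_entry[of g, OF g] case_prod_unfold
    \<comment> \<open>Fixing \<open>B\<close> lets the rewriting move only the kernel sum
      outward.\<close>
    by (simp only: sum.swap[where B = "kernel_indices L"])
  also have "\<dots> = (\<Sum>j<d_in L. \<Sum>x\<in>kernel_indices L. g (kern L (i + 1) (j + 1) (fst x) (snd x)) *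
      ((\<Sum>y<h_in L. of_bool (u * s\<^sub>1 L + fst x = y + 1 + p\<^sub>1 L)) *
       (\<Sum>z<w_in L. of_bool (v * s\<^sub>2 L + snd x = z + 1 + p\<^sub>2 L))))"
    unfolding sum_product by (simp only: sum_distrib_left)
  also have "\<dots> = (\<Sum>j<d_in L. \<Sum>x\<in>kernel_indices L. g (kern L (i + 1) (j + 1) (fst x) (snd x)) *
      (of_bool (\<exists>y<h_in L. u * s\<^sub>1 L + fst x = y + 1 + p\<^sub>1 L) *
       of_bool (\<exists>z<w_in L. v * s\<^sub>2 L + snd x = z + 1 + p\<^sub>2 L)))"
  proof -
    have "(\<Sum>y<h. of_bool (q = y + 1 + p)) = (of_bool (\<exists>y<h. q = y + 1 + p) :: real)" for q h p :: nat
      unfolding ex_less_bex by (intro sum_of_bool_unique) auto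
    then show ?thesis by (simp only:)
  qed
  finally show ?thesis
    by (simp add: sum.atLeast1_atMost_eq[of _ "d_in L"] sum_kernel_indices)
qed

text \<open>One spatial direction of the kernel positions that meet the 0-based input position \<open>y\<close>.\<close>

definition hits :: "nat \<Rightarrow> nat \<Rightarrow> nat \<Rightarrow> nat \<Rightarrow> nat \<Rightarrow> nat set" where
  "hits K s p h' y = {k \<in> {1..K}. \<exists>u<h'. u * s + k = y + 1 + p}"

text \<open>Since the strides are positive, an input position and a kernel position determine at
  most one output position. The conditions on \<open>k\<close> and \<open>t\<close> are independent,
  hence the Cartesian product.\<close>

lemma conv_matrix_col_sum:
  assumes n: "n < d_in L * h_in L * w_in L" and g: "g 0 = (0::real)"
    and s: "0 < s\<^sub>1 L" "0 < s\<^sub>2 L"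
  shows "(\<Sum>r<d_out L * h_out L * w_out L. g (conv_matrix L $$ (r, n))) =
    (\<Sum>(k, t)\<in>hits (k\<^sub>1 L) (s\<^sub>1 L) (p\<^sub>1 L) (h_out L) (n mod (h_in L * w_in L) div w_in L) \<times>
              hits (k\<^sub>2 L) (s\<^sub>2 L) (p\<^sub>2 L) (w_out L) (n mod w_in L).
       \<Sum>i = 1..d_out L. g (kern L i (n div (h_in L * w_in L) + 1) k t))"
proof -
  define j y z where "j = n div (h_in L * w_in L)" and "y = n mod (h_in L * w_in L) div w_in L"
    and "z = n mod w_in L"
  let ?G = "\<lambda>k t. \<Sum>i = 1..d_out L. g (kern L i (j + 1) k t)"
  have G: "?G k t = (\<Sum>i<d_out L. g (kern L (i + 1) (j + 1) k t))" for k t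
    by (simp add: sum.atLeast1_atMost_eq)
  have "(\<Sum>r<d_out L * h_out L * w_out L. g (conv_matrix L $$ (r, n))) =
    (\<Sum>r<d_out L * h_out L * w_out L. g (conv_entry L
      (r div (h_out L * w_out L)) (r mod (h_out L * w_out L) div w_out L) (r mod w_out L) j y z))"
    using conv_matrix_index[OF _ n] by (simp add: j_def y_def z_def)
  also have "\<dots> = (\<Sum>i<d_out L. \<Sum>u<h_out L. \<Sum>v<w_out L. g (conv_entry L i u v j y z))"
    by (rule sum_row_major)
  also have "\<dots> = (\<Sum>x\<in>kernel_indices L. \<Sum>i<d_out L. \<Sum>u<h_out L. \<Sum>v<w_out L.
      g (kern L (i + 1) (j + 1) (fst x) (snd x)) *
      (of_bool (u * s\<^sub>1 L + fst x = y + 1 + p\<^sub>1 L) * of_bool (v * s\<^sub>2 L + snd x = z + 1 + p\<^sub>2 L)))"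
    unfolding apply_conv_entry[of g, OF g] case_prod_unfold
    by (simp only: sum.swap[where B = "kernel_indices L"])
  also have "\<dots> = (\<Sum>x\<in>kernel_indices L. ?G (fst x) (snd x) *
      ((\<Sum>u<h_out L. of_bool (u * s\<^sub>1 L + fst x = y + 1 + p\<^sub>1 L)) *
       (\<Sum>v<w_out L. of_bool (v * s\<^sub>2 L + snd x = z + 1 + p\<^sub>2 L))))"
    by (simp only: G sum_mult_sum_mult_sum)
  also have "\<dots> = (\<Sum>x\<in>kernel_indices L. ?G (fst x) (snd x) *
      (of_bool (\<exists>u<h_out L. u * s\<^sub>1 L + fst x = y + 1 + p\<^sub>1 L) *
       of_bool (\<exists>v<w_out L. v * s\<^sub>2 L + snd x = z + 1 + p\<^sub>2 L)))"
  proof -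
    have "(\<Sum>u<h'. of_bool (u * q + c = m)) = (of_bool (\<exists>u<h'. u * q + c = m) :: real)"
      if "0 < q" for h' q c m :: nat
      unfolding ex_less_bex
    proof (rule sum_of_bool_unique)
      fix x x' assume "x * q + c = m" "x' * q + c = m"
      then have "x * q = x' * q" by linarith
      then show "x = x'" using that by simp
    qed simp
    then show ?thesis using s by (simp only:)
  qed
  also have "\<dots> = (\<Sum>x\<in>kernel_indices L. if x \<in> hits (k\<^sub>1 L) (s\<^sub>1 L) (p\<^sub>1 L) (h_out L) y \<times>
      hits (k\<^sub>2 L) (s\<^sub>2 L) (p\<^sub>2 L) (w_out L) z then ?G (fst x) (snd x) else 0)"
    by (intro sum.cong) (auto simp: hits_def kernel_indices_def)
  also have "\<dots> = (\<Sum>(k, t)\<in>hits (k\<^sub>1 L) (s\<^sub>1 L) (p\<^sub>1 L) (h_out L) y \<times>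
      hits (k\<^sub>2 L) (s\<^sub>2 L) (p\<^sub>2 L) (w_out L) z. ?G k t)"
    by (rule sum.mono_neutral_cong_right) (auto simp: hits_def kernel_indices_def)
  finally show ?thesis unfolding j_def y_def z_def .
qed


section \<open>Index classes\<close>

definition class1 :: "nat \<Rightarrow> nat \<Rightarrow> nat \<Rightarrow> nat \<Rightarrow> nat set" where
  "class1 K s H a = {c \<in> {1..K}. [c = a] (mod s) \<and> a \<le> c \<and> c - a \<le> H}"

text \<open>Reduces the comparison with \<open>hits\<close> to one direction at a time.\<close>

lemma index_class_Times:
  "index_class L (a, b) = class1 (k\<^sub>1 L) (s\<^sub>1 L) (h_in L + 2 * p\<^sub>1 L - k\<^sub>1 L) a \<times>
     class1 (k\<^sub>2 L) (s\<^sub>2 L) (w_in L + 2 * p\<^sub>2 L - k\<^sub>2 L) b"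
  unfolding index_class_def class1_def kernel_indices_def stride_equiv_def prod.case by blast

text \<open>Makes \<open>hits\<close> comparable with \<open>class1\<close>: both are parts of a
  residue class mod \<open>s\<close> within a window of length \<open>H\<close>. Here the window
  ends at the padded position \<open>y + 1 + p\<close>; in \<open>class1\<close> it starts at
  \<open>a\<close>.\<close>

lemma hits_alt:
  assumes "0 < s"
  shows "k \<in> hits K s p (H div s + 1) y \<longleftrightarrow>
    1 \<le> k \<and> k \<le> K \<and> [k = y + 1 + p] (mod s) \<and> k \<le> y + 1 + p \<and> y + 1 + p \<le> k + H"
proof
  assume "k \<in> hits K s p (H div s + 1) y"
  then obtain u where u: "1 \<le> k" "k \<le> K" "u \<le> H div s" "u * s + k = y + 1 + p"
    by (auto simp: hits_def less_Suc_eq_le)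
  have "u * s \<le> H" using u(3) assms by (simp add: less_eq_div_iff_mult_less_eq)
  moreover have "[k = u * s + k] (mod s)" by (simp add: cong_def)
  ultimately show "1 \<le> k \<and> k \<le> K \<and> [k = y + 1 + p] (mod s) \<and> k \<le> y + 1 + p \<and> y + 1 + p \<le> k + H"
    using u by auto
next
  assume *: "1 \<le> k \<and> k \<le> K \<and> [k = y + 1 + p] (mod s) \<and> k \<le> y + 1 + p \<and> y + 1 + p \<le> k + H"
  then obtain u where u: "y + 1 + p = u * s + k"
    by (metis cong_sym cong_le_nat)
  then have "u * s \<le> H" using * by linarith
  then have "u \<le> H div s" using assms by (simp add: less_eq_div_iff_mult_less_eq)
  then show "k \<in> hits K s p (H div s + 1) y" using * u by (auto simp: hits_def less_Suc_eq_le intro!: exI[of _ u])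
qed

text \<open>The least element of a nonempty hit set can serve as \<open>a\<close>: all elements are
  congruent and share a window of length \<open>H\<close>, so none exceeds the least by more than
  \<open>H\<close>.\<close>

lemma hits_subset_class1:
  assumes "0 < s" "0 < K"
  shows "\<exists>a\<in>{1..K}. hits K s p (H div s + 1) y \<subseteq> class1 K s H a"
proof (cases "hits K s p (H div s + 1) y = {}")
  \<comment> \<open>The hit set can be empty, for instance at positions skipped by a stride larger
    than the kernel; then any start works.\<close>
  case True
  then show ?thesis using assms by (intro bexI[of _ 1]) auto
next
  case False
  let ?B = "hits K s p (H div s + 1) y"
  have fin: "finite ?B" by (simp add: hits_def)
  have a: "Min ?B \<in> ?B" using fin False by (rule Min_in)
  have "c \<in> class1 K s H (Min ?B)" if c: "c \<in> ?B" for c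
    using a c Min_le[OF fin c] unfolding hits_alt[OF assms(1)] class1_def
    by (auto intro: cong_trans cong_sym)
  moreover have "Min ?B \<in> {1..K}" using a by (simp add: hits_def)
  ultimately show ?thesis by blast
qed

text \<open>The largest element \<open>m\<close> of the class serves as the padded input position, unless it lies in
  the padding; in that case it is moved into the input by \<open>c * s\<close>.\<close>

lemma class1_subset_hits:
  assumes "0 < s" "a \<in> {1..K}" "p \<le> c * s" "K + c * s \<le> h + p"
  shows "\<exists>y<h. class1 K s (h + 2 * p - K) a \<subseteq> hits K s p ((h + 2 * p - K) div s + 1) y"
proof -
  let ?H = "h + 2 * p - K"
  let ?A = "class1 K s ?H a"
  have fin: "finite ?A" by (simp add: class1_def)
  have aA: "a \<in> ?A" using assms by (simp add: class1_def)
  define m where "m = Max ?A"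
  have mA: "m \<in> ?A" unfolding m_def using fin aA by (intro Max_in) auto
  have le: "c \<le> m" if "c \<in> ?A" for c unfolding m_def using fin that by simp
  have m: "1 \<le> m" "m \<le> K" "[m = a] (mod s)" "m \<le> a + ?H" "a \<le> m"
    using mA by (auto simp: class1_def)
  \<comment> \<open>\<open>Y\<close> is a 1-based padded position. The first two conditions keep it
    out of the padding; the last two make the window from \<open>Y - ?H\<close> to \<open>Y\<close>
    cover the class, which lies between \<open>a\<close> and \<open>m\<close>.\<close>
  obtain Y where Y: "p < Y" "Y \<le> p + h" "[Y = a] (mod s)" "m \<le> Y" "Y \<le> a + ?H"
  proof (cases "p < m")
    case True
    then show ?thesis using m assms by (intro that[of m]) auto
  next
    case False
    \<comment> \<open>As \<open>m <= p\<close>, the shifted position is at most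
      \<open>p + c * s\<close>, which is at most \<open>?H\<close> by the size assumption. It
      exceeds \<open>p\<close> because \<open>1 <= m\<close> and \<open>p <= c * s\<close>.\<close>
    have "[m + c * s = a] (mod s)" using m(3) by (simp add: cong_def)
    then show ?thesis using False m assms by (intro that[of "m + c * s"]) auto
  qed
  have "?A \<subseteq> hits K s p (?H div s + 1) (Y - 1 - p)"
  proof
    fix x assume x: "x \<in> ?A"
    have "[x = Y] (mod s)" using x Y(3) by (auto simp: class1_def intro: cong_trans cong_sym)
    moreover have "1 \<le> x" "x \<le> K" "a \<le> x" using x by (auto simp: class1_def)
    ultimately show "x \<in> hits K s p (?H div s + 1) (Y - 1 - p)"
      unfolding hits_alt[OF assms(1)] using le[OF x] Y by auto
  qed
  then show ?thesis using Y by (intro exI[of _ "Y - 1 - p"]) auto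
qed


section \<open>The norm formulas\<close>

lemma least_multiple_ge:
  fixes p s :: nat
  assumes "0 < s" "c = (LEAST c. 0 < c \<and> p \<le> c * s)"
  shows "p \<le> c * s"
proof -
  \<comment> \<open>A witness that \<open>LEAST\<close> ranges over a nonempty set.\<close>
  have "0 < Suc p \<and> p \<le> Suc p * s" using assms(1) by (cases s) auto
  then have "0 < c \<and> p \<le> c * s" unfolding assms(2) by (rule LeastI)
  then show ?thesis by simp
qed

theorem theorem1:
  fixes L :: conv_layer and c\<^sub>1 c\<^sub>2 :: nat
  assumes "0 < d_in L" "0 < h_in L" "0 < w_in L" "0 < d_out L"
    and "0 < k\<^sub>1 L" "0 < k\<^sub>2 L" "0 < s\<^sub>1 L" "0 < s\<^sub>2 L"
    and "c\<^sub>1 = (LEAST c. 0 < c \<and> p\<^sub>1 L \<le> c * s\<^sub>1 L)"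
    and "c\<^sub>2 = (LEAST c. 0 < c \<and> p\<^sub>2 L \<le> c * s\<^sub>2 L)"
    and "k\<^sub>1 L + c\<^sub>1 * s\<^sub>1 L - p\<^sub>1 L \<le> h_in L"
    and "k\<^sub>2 L + c\<^sub>2 * s\<^sub>2 L - p\<^sub>2 L \<le> w_in L"
  shows
    "conv_norm 1 L =
       (MAX j\<in>{1..d_in L}. MAX A\<in>index_classes L. \<Sum>(k, t)\<in>A. \<Sum>i = 1..d_out L. \<bar>kern L i j k t\<bar>) \<and>
     conv_norm \<infinity> L =
       (MAX i\<in>{1..d_out L}. \<Sum>j = 1..d_in L. \<Sum>k = 1..k\<^sub>1 L. \<Sum>t = 1..k\<^sub>2 L. \<bar>kern L i j k t\<bar>) \<and>
     conv_norm 2 L \<le>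
       sqrt (real (h_out L * w_out L) *
         (\<Sum>i = 1..d_out L. \<Sum>j = 1..d_in L. \<Sum>k = 1..k\<^sub>1 L. \<Sum>t = 1..k\<^sub>2 L. \<bar>kern L i j k t\<bar>\<^sup>2))"
proof -
  let ?m = "d_out L * h_out L * w_out L" and ?n = "d_in L * h_in L * w_in L"
  note dims[simp] = carrier_matD[OF conv_matrix_carrier[of L]]
  have out: "0 < h_out L" "0 < w_out L" by (simp_all add: h_out_def w_out_def)
  have c: "p\<^sub>1 L \<le> c\<^sub>1 * s\<^sub>1 L" "p\<^sub>2 L \<le> c\<^sub>2 * s\<^sub>2 L"
    using least_multiple_ge assms(7-10) by blast+
  have fit: "k\<^sub>1 L + c\<^sub>1 * s\<^sub>1 L \<le> h_in L + p\<^sub>1 L" "k\<^sub>2 L + c\<^sub>2 * s\<^sub>2 L \<le> w_in L + p\<^sub>2 L"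
    using assms(11,12) c by linarith+
  have n0: "0 < ?n" using assms(1-3) by simp

  have "conv_norm 1 L =
    (MAX j\<in>{1..d_in L}. MAX A\<in>index_classes L. \<Sum>(k, t)\<in>A. \<Sum>i = 1..d_out L. \<bar>kern L i j k t\<bar>)"
  proof -
    define G where "G j A = (\<Sum>(k, t)\<in>A. \<Sum>i = 1..d_out L. \<bar>kern L i j k t\<bar>)" for j A
    let ?R = "MAX j\<in>{1..d_in L}. MAX A\<in>index_classes L. G j A"
    let ?H\<^sub>1 = "h_in L + 2 * p\<^sub>1 L - k\<^sub>1 L" and ?H\<^sub>2 = "w_in L + 2 * p\<^sub>2 L - k\<^sub>2 L"
    let ?B = "\<lambda>y z. hits (k\<^sub>1 L) (s\<^sub>1 L) (p\<^sub>1 L) (h_out L) y \<times> hits (k\<^sub>2 L) (s\<^sub>2 L) (p\<^sub>2 L) (w_out L) z"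
    have fin: "finite (index_classes L)" by (simp add: index_classes_def kernel_indices_def)
    have ne: "index_classes L \<noteq> {}"
      using assms(5,6) by (auto simp: index_classes_def kernel_indices_def)
    \<comment> \<open>By this monotonicity it suffices to cover each hit set by a class and each
      class by a hit set.\<close>
    have mono: "G j A \<le> G j B" if "A \<subseteq> B" "finite B" for j A B
      unfolding G_def using that by (intro sum_mono2) (auto intro: sum_nonneg)
    have col: "(\<Sum>r<?m. \<bar>conv_matrix L $$ (r, n)\<bar>) =
        G (n div (h_in L * w_in L) + 1) (?B (n mod (h_in L * w_in L) div w_in L) (n mod w_in L))"
      if "n < ?n" for n
      unfolding G_def using that assms(7,8) by (intro conv_matrix_col_sum) auto
    have "lp_op_norm 1 (conv_matrix L) = ?R"
    proof -
      have le: "(\<Sum>r<?m. \<bar>conv_matrix L $$ (r, n)\<bar>) \<le> ?R" if n: "n < ?n" for n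
      proof -
        let ?j = "n div (h_in L * w_in L) + 1"
          and ?y = "n mod (h_in L * w_in L) div w_in L" and ?z = "n mod w_in L"
        obtain a b where ab: "a \<in> {1..k\<^sub>1 L}" "b \<in> {1..k\<^sub>2 L}"
          "hits (k\<^sub>1 L) (s\<^sub>1 L) (p\<^sub>1 L) (h_out L) ?y \<subseteq> class1 (k\<^sub>1 L) (s\<^sub>1 L) ?H\<^sub>1 a"
          "hits (k\<^sub>2 L) (s\<^sub>2 L) (p\<^sub>2 L) (w_out L) ?z \<subseteq> class1 (k\<^sub>2 L) (s\<^sub>2 L) ?H\<^sub>2 b"
          unfolding h_out_def w_out_def using hits_subset_class1 assms(5-8) by metis
        have A: "index_class L (a, b) \<in> index_classes L"
          using ab(1,2) by (auto simp: index_classes_def kernel_indices_def)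
        have "G ?j (?B ?y ?z) \<le> G ?j (index_class L (a, b))"
          using ab(3,4) by (intro mono) (auto simp: index_class_Times class1_def)
        also have "\<dots> \<le> (MAX A\<in>index_classes L. G ?j A)"
          using fin A by (intro Max_ge) auto
        also have "\<dots> \<le> ?R"
          using row_major_index_bounds(1)[OF n] by (intro Max_ge) auto
        finally show ?thesis using col[OF n] by simp
      qed
      have "?R \<in> (\<lambda>j. MAX A\<in>index_classes L. G j A) ` {1..d_in L}"
        using assms(1) by (intro Max_in) auto
      then obtain j where j: "j \<in> {1..d_in L}" "?R = (MAX A\<in>index_classes L. G j A)" by blast
      have "(MAX A\<in>index_classes L. G j A) \<in> G j ` index_classes L"
        using fin ne by (intro Max_in) auto
      then obtain a b where ab: "a \<in> {1..k\<^sub>1 L}" "b \<in> {1..k\<^sub>2 L}" "?R = G j (index_class L (a, b))"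
        unfolding j(2) by (auto simp: index_classes_def kernel_indices_def)
      \<comment> \<open>The column of this input position contains the whole maximising class and so
        attains the maximum.\<close>
      obtain y z where yz: "y < h_in L" "z < w_in L"
        "class1 (k\<^sub>1 L) (s\<^sub>1 L) ?H\<^sub>1 a \<subseteq> hits (k\<^sub>1 L) (s\<^sub>1 L) (p\<^sub>1 L) (h_out L) y"
        "class1 (k\<^sub>2 L) (s\<^sub>2 L) ?H\<^sub>2 b \<subseteq> hits (k\<^sub>2 L) (s\<^sub>2 L) (p\<^sub>2 L) (w_out L) z"
        unfolding h_out_def w_out_def
        using class1_subset_hits[OF assms(7) ab(1) c(1) fit(1)]
          class1_subset_hits[OF assms(8) ab(2) c(2) fit(2)] by auto
      define m where "m = ((j - 1) * h_in L + y) * w_in L + z"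
      have m: "m < ?n" unfolding m_def using j(1) yz by (intro row_major_bound) auto
      have "m div (h_in L * w_in L) = j - 1 \<and> m mod (h_in L * w_in L) div w_in L = y \<and> m mod w_in L = z"
        using row_major_unique[OF yz(1,2)] m_def by blast
      then have "(\<Sum>r<?m. \<bar>conv_matrix L $$ (r, m)\<bar>) = G j (?B y z)"
        using col[OF m] j(1) by simp
      moreover have "G j (index_class L (a, b)) \<le> G j (?B y z)"
        using yz(3,4) by (intro mono) (auto simp: index_class_Times hits_def)
      ultimately show ?thesis
        using ab(3) m le by (intro lp_op_norm_1_eqI[of _ _ m]) auto
    qed
    then show ?thesis by (simp add: conv_norm_def G_def)
  qed

  moreover have "conv_norm \<infinity> L =
    (MAX i\<in>{1..d_out L}. \<Sum>j = 1..d_in L. \<Sum>k = 1..k\<^sub>1 L. \<Sum>t = 1..k\<^sub>2 L. \<bar>kern L i j k t\<bar>)"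
    (is "_ = Max (?F ` _)")
  proof -
    let ?R = "MAX i\<in>{1..d_out L}. ?F i"
    have le: "(\<Sum>n<?n. \<bar>conv_matrix L $$ (r, n)\<bar>) \<le> ?R" if r: "r < ?m" for r
    proof -
      \<comment> \<open>Part of the filter may fall on the padding; bounding the indicators by 1
        gives the full filter sum.\<close>
      have "(\<Sum>n<?n. \<bar>conv_matrix L $$ (r, n)\<bar>) \<le> ?F (r div (h_out L * w_out L) + 1)"
        by (subst conv_matrix_row_sum[OF r]) (auto intro!: sum_mono simp: mult_left_le)
      also have "\<dots> \<le> ?R"
        using row_major_index_bounds(1)[OF r] by (intro Max_ge) auto
      finally show ?thesis .
    qed
    have "?R \<in> ?F ` {1..d_out L}" using assms(4) by (intro Max_in) auto
    then obtain i where i: "i \<in> {1..d_out L}" "?R = ?F i" by blast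
    \<comment> \<open>By \<open>fit\<close>, the offset \<open>c\<^sub>1 * s\<^sub>1 L\<close> is at
      most the padded height minus the kernel height, and likewise for the width, so this output
      position exists.\<close>
    have uv: "c\<^sub>1 < h_out L" "c\<^sub>2 < w_out L"
      using c fit assms(7,8)
      by (auto simp: h_out_def w_out_def less_Suc_eq_le less_eq_div_iff_mult_less_eq)
    \<comment> \<open>At this output position the whole kernel lies inside the unpadded input.\<close>
    define m where "m = ((i - 1) * h_out L + c\<^sub>1) * w_out L + c\<^sub>2"
    have m: "m < ?m" unfolding m_def using i(1) uv by (intro row_major_bound) auto
    have m_eq: "m div (h_out L * w_out L) = i - 1" "m mod (h_out L * w_out L) div w_out L = c\<^sub>1"
        "m mod w_out L = c\<^sub>2"
      using row_major_unique[OF uv] m_def by blast+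
    \<comment> \<open>The proper input occupies the 1-based padded positions \<open>p + 1\<close> to
      \<open>p + h\<close>, and \<open>q + k\<close> lies among them.\<close>
    have inside: "\<exists>y<h. q + k = y + 1 + p" if "k \<in> {1..K}" "p \<le> q" "K + q \<le> h + p" for k K p q h :: nat
      using that by (intro exI[of _ "q + k - 1 - p"]) auto
    have "(\<Sum>n<?n. \<bar>conv_matrix L $$ (m, n)\<bar>) = ?F i"
      unfolding conv_matrix_row_sum[OF m, of abs, simplified m_eq, OF abs_zero] m_eq
      using i(1) inside[OF _ c(1) fit(1)] inside[OF _ c(2) fit(2)]
      by (intro sum.cong refl) auto
    then show ?thesis
      unfolding conv_norm_def using m le i(2) n0 by (intro lp_op_norm_inf_eqI[of _ _ m]) auto
  qed

  moreover have "conv_norm 2 L \<le> sqrt (real (h_out L * w_out L) *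
    (\<Sum>i = 1..d_out L. \<Sum>j = 1..d_in L. \<Sum>k = 1..k\<^sub>1 L. \<Sum>t = 1..k\<^sub>2 L. \<bar>kern L i j k t\<bar>\<^sup>2))"
  proof -
    let ?F = "\<lambda>i. \<Sum>j = 1..d_in L. \<Sum>k = 1..k\<^sub>1 L. \<Sum>t = 1..k\<^sub>2 L. \<bar>kern L i j k t\<bar>\<^sup>2"
    \<comment> \<open>Each row is bounded by the squares of its whole filter, and each filter
      belongs to \<open>h_out L * w_out L\<close> rows, which gives the factor in the bound.\<close>
    have "(\<Sum>r<?m. \<Sum>n<?n. (conv_matrix L $$ (r, n))\<^sup>2) \<le> (\<Sum>r<?m. ?F (r div (h_out L * w_out L) + 1))"
    proof (rule sum_mono)
      fix r assume "r \<in> {..<?m}"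
      then have r: "r < ?m" by simp
      show "(\<Sum>n<?n. (conv_matrix L $$ (r, n))\<^sup>2) \<le> ?F (r div (h_out L * w_out L) + 1)"
        by (subst conv_matrix_row_sum[OF r]) (auto intro!: sum_mono simp: mult_left_le)
    qed
    also have "\<dots> = (\<Sum>i<d_out L. \<Sum>u<h_out L. \<Sum>v<w_out L. ?F (i + 1))"
      by (rule sum_row_major)
    also have "\<dots> = real (h_out L * w_out L) * (\<Sum>i = 1..d_out L. ?F i)"
      by (simp add: sum.atLeast1_atMost_eq sum_distrib_left mult.assoc)
    finally have "sqrt (\<Sum>r<?m. \<Sum>n<?n. (conv_matrix L $$ (r, n))\<^sup>2)
        \<le> sqrt (real (h_out L * w_out L) * (\<Sum>i = 1..d_out L. ?F i))"
      by (rule real_sqrt_le_mono)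
    then show ?thesis
      unfolding conv_norm_def
      using lp_op_norm_2_le_frobenius[of "conv_matrix L", unfolded dims, OF n0] by linarith
  qed
  ultimately show ?thesis by blast
qed

end
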